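(* Let $n\ge 1$. In the orthogonal group $O(n)$, any relation among reflections in hyperplanes follows from pencil and involution relations. That is, if $H_1,\dots,H_k$ are hyperplanes (vector subspaces of codimension 1) in $\mathbb{R}^n$ with $R_{H_1}\circ R_{H_2}\circ\dots\circ R_{H_k}=\mathrm{id}$, then this relation is a consequence of pencil relations and involution relations.
   Context: For a hyperplane (codimension 1 vector subspace) $H\subset\mathbb{R}^n$, $R_H\in O(n)$ denotes the orthogonal reflection in $H$. A pencil relation is an equality $R_M\circ R_L=R_{M'}\circ R_{L'}$ that holds in $O(n)$, where $L,M,L',M'$ are hyperplanes all containing one common vector subspace of codimension 2 (such an equality expresses the non-uniqueness of the representation of a rotation about a codimension 2 subspace as a composition of two reflections in hyperplanes). An involution relation is an equality $R_H^2=\mathrm{id}$. A relation $R_{H_1}\circ\dots\circ R_{H_k}=\mathrm{id}$ follows from (is a consequence of) these relations if, in the free group on the set of symbols $\{r_H\}$ indexed by all hyperplanes $H$ of $\mathbb{R}^n$, the word $r_{H_1}r_{H_2}\cdots r_{H_k}$ lies in the normal closure of the set of all elements $r_H^2$ and all elements $r_Mr_L(r_{M'}r_{L'})^{-1}$ corresponding to involution and pencil relations. *)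

theory Defs
  imports "HOL-Analysis.Analysis" "HOL-Algebra.Coset"
begin

section \<open>Free groups and normal closures\<close>

text \<open>
  Elements of the free group on \<open>A\<close> are the reduced words over the letters \<open>(a, True)\<close>, standing for
  the generator \<open>a\<close>, and \<open>(a, False)\<close>, standing for its inverse.
\<close>

definition letter_inv :: "'a \<times> bool \<Rightarrow> 'a \<times> bool" where
  "letter_inv x = (fst x, \<not> snd x)"

definition reduced_word :: "('a \<times> bool) list \<Rightarrow> bool" where
  "reduced_word w \<longleftrightarrow> (\<forall>i. Suc i < length w \<longrightarrow> w ! i \<noteq> letter_inv (w ! Suc i))"

fun push :: "'a \<times> bool \<Rightarrow> ('a \<times> bool) list \<Rightarrow> ('a \<times> bool) list" where
  "push x [] = [x]"
| "push x (y # w) = (if x = letter_inv y then w else x # y # w)"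

text \<open>
  \<open>foldr push u v\<close> is the reduced form of the concatenation \<open>u @ v\<close> when \<open>v\<close> is reduced: the letters
  of \<open>u\<close> are put in front of \<open>v\<close> one at a time, cancelling where possible.
\<close>

definition free_group :: "'a set \<Rightarrow> ('a \<times> bool) list monoid" where
  "free_group A =
     \<lparr>carrier = {w. fst ` set w \<subseteq> A \<and> reduced_word w},
      monoid.mult = (\<lambda>u v. foldr push u v),
      one = []\<rparr>"

definition free_gen :: "'a \<Rightarrow> ('a \<times> bool) list" where
  "free_gen a = [(a, True)]"

definition normal_closure :: "('a, 'b) monoid_scheme \<Rightarrow> 'a set \<Rightarrow> 'a set" where
  "normal_closure G R = (\<lambda>N. N \<lhd> G) hull R"

lemma letter_inv_inv [simp]: "letter_inv (letter_inv x) = x"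
  by (simp add: letter_inv_def)

lemma letter_inv_neq [simp]: "letter_inv x \<noteq> x" "x \<noteq> letter_inv x"
  by (auto simp: letter_inv_def prod_eq_iff)

lemma fst_letter_inv [simp]: "fst (letter_inv x) = fst x"
  by (simp add: letter_inv_def)

lemma reduced_Nil [simp]: "reduced_word []"
  by (simp add: reduced_word_def)

lemma reduced_single [simp]: "reduced_word [x]"
  by (simp add: reduced_word_def)

lemma reduced_Cons_Cons [simp]:
  "reduced_word (x # y # w) \<longleftrightarrow> x \<noteq> letter_inv y \<and> reduced_word (y # w)"
  unfolding reduced_word_def by (auto simp: nth_Cons split: nat.splits)

lemma reduced_tl: "reduced_word (x # w) \<Longrightarrow> reduced_word w"
  by (cases w) auto

lemma reduced_push: "reduced_word w \<Longrightarrow> reduced_word (push x w)"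
  by (cases w) (auto dest: reduced_tl)

lemma push_push_inv: "reduced_word w \<Longrightarrow> push x (push (letter_inv x) w) = w"
proof (cases w)
  case (Cons y v)
  assume "reduced_word w"
  with Cons show ?thesis
    by (cases v) (auto, (metis letter_inv_inv)+)
qed simp

lemma push_reduced: "reduced_word (x # w) \<Longrightarrow> push x w = x # w"
  by (cases w) auto

lemma reduced_foldr_push: "reduced_word v \<Longrightarrow> reduced_word (foldr push u v)"
  by (induction u) (auto intro: reduced_push)

lemma fst_set_push: "fst ` set (push x w) \<subseteq> insert (fst x) (fst ` set w)"
  by (cases w) auto

lemma fst_set_foldr_push: "fst ` set (foldr push u v) \<subseteq> fst ` set u \<union> fst ` set v"
proof (induction u)
  case (Cons x u)
  have "fst ` set (foldr push (x # u) v) \<subseteq> insert (fst x) (fst ` set (foldr push u v))"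
    using fst_set_push[of x "foldr push u v"] by simp
  also have "\<dots> \<subseteq> fst ` set (x # u) \<union> fst ` set v"
    using Cons.IH by (simp add: subset_iff)
  finally show ?case .
qed simp

lemma foldr_push_push:
  assumes "reduced_word v"
  shows "foldr push (push x u) v = push x (foldr push u v)"
proof (cases u)
  case (Cons y w)
  then show ?thesis
    using push_push_inv[OF reduced_foldr_push[OF assms], of x w]
    by auto
qed simp

lemma foldr_push_assoc:
  "reduced_word w \<Longrightarrow> foldr push (foldr push u v) w = foldr push u (foldr push v w)"
  by (induction u) (simp_all add: foldr_push_push)

lemma foldr_push_Nil: "reduced_word u \<Longrightarrow> foldr push u [] = u"
proof (induction u)
  case (Cons x u)
  then show ?case using reduced_tl[of x u] push_reduced[of x u] by simp
qed simp

lemma foldr_push_inverse: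
  "reduced_word v \<Longrightarrow> foldr push (rev (map letter_inv u)) (foldr push u v) = v"
proof (induction u)
  case (Cons x u)
  have "push (letter_inv x) (push x (foldr push u v)) = foldr push u v"
    using push_push_inv[OF reduced_foldr_push[OF Cons.prems], of "letter_inv x" u] by simp
  with Cons show ?case by simp
qed simp

lemma group_free_group: "group (free_group A)"
proof (rule groupI, goal_cases)
  case (1 u v)
  then have "fst ` set u \<union> fst ` set v \<subseteq> A" by (simp add: free_group_def)
  with 1 show ?case
    using order_trans[OF fst_set_foldr_push[of u v]] by (simp add: free_group_def reduced_foldr_push)
next
  case 2
  then show ?case by (simp add: free_group_def)
next
  case (3 u v w)
  then show ?case by (simp add: free_group_def foldr_push_assoc)
next
  case (4 u)
  then show ?case by (simp add: free_group_def)
next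
  case (5 u)
  let ?v = "foldr push (rev (map letter_inv u)) []"
  have "fst ` set ?v \<subseteq> A"
    using 5 fst_set_foldr_push[of "rev (map letter_inv u)" "[]"]
    by (auto simp: free_group_def image_image)
  moreover have "foldr push ?v u = []"
    using 5 foldr_push_inverse[of "[]" u] foldr_push_assoc[of u "rev (map letter_inv u)" "[]"]
    by (simp add: free_group_def foldr_push_Nil)
  ultimately show ?case
    by (auto simp: free_group_def reduced_foldr_push intro!: exI[of _ ?v])
qed

lemma free_gen_closed: "a \<in> A \<Longrightarrow> free_gen a \<in> carrier (free_group A)"
  by (simp add: free_group_def free_gen_def)


section \<open>Reflections in hyperplanes\<close>

definition hyperplane :: "'a::euclidean_space set \<Rightarrow> bool" where
  "hyperplane H \<longleftrightarrow> subspace H \<and> dim H + 1 = DIM('a)"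

definition hyperplane_reflection :: "'a::euclidean_space set \<Rightarrow> 'a \<Rightarrow> 'a" where
  "hyperplane_reflection H x = (THE y. \<exists>u\<in>H. \<exists>v\<in>H\<^sup>\<bottom>. x = u + v \<and> y = u - v)"

lemma hyperplane_reflection_eq:
  fixes H :: "'a::euclidean_space set"
  assumes "subspace H" "u \<in> H" "v \<in> H\<^sup>\<bottom>"
  shows "hyperplane_reflection H (u + v) = u - v"
  unfolding hyperplane_reflection_def
proof (rule the_equality)
  show "\<exists>u'\<in>H. \<exists>v'\<in>H\<^sup>\<bottom>. u + v = u' + v' \<and> u - v = u' - v'"
    using assms by blast
next
  fix y assume "\<exists>u'\<in>H. \<exists>v'\<in>H\<^sup>\<bottom>. u + v = u' + v' \<and> y = u' - v'"
  then obtain u' v' where *: "u' \<in> H" "v' \<in> H\<^sup>\<bottom>" "u + v = u' + v'" "y = u' - v'"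
    by blast
  define d where "d = u - u'"
  have "d = v' - v" using *(3) by (simp add: d_def algebra_simps)
  then have "d \<in> H\<^sup>\<bottom>"
    using *(2) assms(3) by (simp add: subspace_diff[OF subspace_orthogonal_comp])
  moreover have "d \<in> H" using assms(1,2) *(1) by (simp add: d_def subspace_diff)
  ultimately have "d \<bullet> d = 0" unfolding orthogonal_comp_def orthogonal_def by blast
  then have "d = 0" by simp
  with *(3,4) show "y = u - v" by (simp add: d_def)
qed

lemma orthogonal_decomp_exists:
  fixes H :: "'a::euclidean_space set"
  assumes "subspace H"
  obtains u v where "u \<in> H" "v \<in> H\<^sup>\<bottom>" "x = u + v"
proof -
  have "x \<in> H + H\<^sup>\<bottom>" using subspace_sum_orthogonal_comp[OF assms] by simp
  then show ?thesis using that by (auto elim: set_plus_elim)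
qed

lemma orthogonal_transformation_hyperplane_reflection:
  fixes H :: "'a::euclidean_space set"
  assumes H: "subspace H"
  shows "orthogonal_transformation (hyperplane_reflection H)"
proof -
  note eq = hyperplane_reflection_eq[OF H]
  have lin: "linear (hyperplane_reflection H)"
  proof (rule linearI)
    fix x y :: 'a and c :: real
    obtain u v where x: "u \<in> H" "v \<in> H\<^sup>\<bottom>" "x = u + v"
      using orthogonal_decomp_exists[OF H] .
    obtain u' v' where y: "u' \<in> H" "v' \<in> H\<^sup>\<bottom>" "y = u' + v'"
      using orthogonal_decomp_exists[OF H] .
    have "hyperplane_reflection H ((u + u') + (v + v')) = (u + u') - (v + v')"
      using x y H by (intro eq) (auto intro: subspace_add subspace_orthogonal_comp)
    then show "hyperplane_reflection H (x + y) = hyperplane_reflection H x + hyperplane_reflection H y"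
      using eq[OF x(1,2)] eq[OF y(1,2)] x(3) y(3) by (simp add: add_ac add_diff_eq diff_add_eq diff_diff_eq)
    have "hyperplane_reflection H (c *\<^sub>R u + c *\<^sub>R v) = c *\<^sub>R u - c *\<^sub>R v"
      using x H by (intro eq) (auto intro: subspace_scale subspace_orthogonal_comp)
    then show "hyperplane_reflection H (c *\<^sub>R x) = c *\<^sub>R hyperplane_reflection H x"
      using eq[OF x(1,2)] x(3) by (simp add: scaleR_right_distrib scaleR_right_diff_distrib)
  qed
  have "norm (hyperplane_reflection H x) = norm x" for x
  proof -
    obtain u v where x: "u \<in> H" "v \<in> H\<^sup>\<bottom>" "x = u + v"
      using orthogonal_decomp_exists[OF H] .
    then have "u \<bullet> v = 0" by (auto simp: orthogonal_comp_def orthogonal_def)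
    moreover have "hyperplane_reflection H x = u - v" using x eq by simp
    ultimately show ?thesis
      using x(3) by (simp add: norm_eq inner_add_left inner_add_right inner_diff_left inner_diff_right inner_commute)
  qed
  with lin show ?thesis by (simp add: orthogonal_transformation)
qed


section \<open>Relations among reflections\<close>

abbreviation reflection_symbol_group :: "('a::euclidean_space set \<times> bool) list monoid" where
  "reflection_symbol_group \<equiv> free_group {H. hyperplane H}"

definition in_common_pencil :: "'a::euclidean_space set set \<Rightarrow> bool" where
  "in_common_pencil \<H> \<longleftrightarrow>
     (\<exists>W. subspace W \<and> dim W + 2 = DIM('a) \<and> (\<forall>H\<in>\<H>. hyperplane H \<and> W \<subseteq> H))"

definition involution_relators :: "('a::euclidean_space set \<times> bool) list set" where
  "involution_relators =
     {free_gen H [^]\<^bsub>reflection_symbol_group\<^esub> (2::nat) | H. hyperplane H}"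

definition pencil_relators :: "('a::euclidean_space set \<times> bool) list set" where
  "pencil_relators =
     {(free_gen M \<otimes>\<^bsub>reflection_symbol_group\<^esub> free_gen L)
        \<otimes>\<^bsub>reflection_symbol_group\<^esub>
        inv\<^bsub>reflection_symbol_group\<^esub>
          (free_gen M' \<otimes>\<^bsub>reflection_symbol_group\<^esub> free_gen L') | L M L' M'.
      in_common_pencil {L, M, L', M'} \<and>
      hyperplane_reflection M \<circ> hyperplane_reflection L =
        hyperplane_reflection M' \<circ> hyperplane_reflection L'}"

definition reflection_word :: "'a::euclidean_space set list \<Rightarrow> ('a set \<times> bool) list" where
  "reflection_word Hs =
     foldr (\<otimes>\<^bsub>reflection_symbol_group\<^esub>) (map free_gen Hs) \<one>\<^bsub>reflection_symbol_group\<^esub>"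

definition follows_from_pencil_and_involution_relations :: "'a::euclidean_space set list \<Rightarrow> bool" where
  "follows_from_pencil_and_involution_relations Hs \<longleftrightarrow>
     reflection_word Hs \<in>
       normal_closure reflection_symbol_group (involution_relators \<union> pencil_relators)"

lemma relators_closed:
  "involution_relators \<union> pencil_relators \<subseteq> carrier reflection_symbol_group"
proof -
  interpret group "reflection_symbol_group :: ('a set \<times> bool) list monoid"
    by (rule group_free_group)
  show ?thesis
    by (auto simp: involution_relators_def pencil_relators_def in_common_pencil_def
        intro!: free_gen_closed m_closed inv_closed nat_pow_closed)
qed

end

theory Submission
  imports Defs
begin

text \<open>
  Write \<open>r\<^sub>a\<close> for the symbol of the hyperplane orthogonal to \<open>a\<close> and fix a vector \<open>e\<close>. The plane spanned
  by \<open>a\<close> and \<open>b\<close> contains some \<open>c \<noteq> 0\<close> orthogonal to \<open>e\<close>, and a pencil relation turns \<open>r\<^sub>a r\<^sub>b\<close> into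
  \<open>r\<^sub>d r\<^sub>c\<close>. Hence every word can be rewritten so that all its letters except possibly the first one
  are orthogonal to \<open>e\<close>. If the word represents the identity, then the first reflection fixes \<open>e\<close>, so
  its letter is orthogonal to \<open>e\<close> as well. Doing this for each vector \<open>e\<close> of a basis, without leaving
  the span of the letters, one arrives at the empty word.
\<close>

section \<open>Reflections and hyperplanes in terms of normal vectors\<close>

text \<open>For \<open>a = 0\<close> this is the identity, the reflection in the whole
  space.\<close>

definition reflect :: "'a::real_inner \<Rightarrow> 'a \<Rightarrow> 'a" where
  "reflect a x = x - (2 * (a \<bullet> x) / (a \<bullet> a)) *\<^sub>R a"

lemma reflect_involution: "reflect a (reflect a x) = x"
  by (cases "a = 0") (simp_all add: reflect_def inner_diff_right algebra_simps)

lemma reflect_scaleR: "k \<noteq> 0 \<Longrightarrow> reflect (k *\<^sub>R a) = reflect a"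
  by (rule ext) (simp add: reflect_def field_simps)

lemma reflect_fix: "a \<bullet> x = 0 \<Longrightarrow> reflect a x = x"
  by (simp add: reflect_def)

lemma reflect_fixD: "reflect a x = x \<Longrightarrow> a \<bullet> x = 0"
  by (cases "a = 0") (simp_all add: reflect_def)

lemma reflect_hyperplane:
  fixes a :: "'a::euclidean_space"
  shows "hyperplane_reflection {x. a \<bullet> x = 0} = reflect a"
proof
  fix x
  define v where "v = ((a \<bullet> x) / (a \<bullet> a)) *\<^sub>R a"
  have "x - v \<in> {x. a \<bullet> x = 0}"
    by (cases "a = 0") (simp_all add: v_def inner_diff_right)
  moreover have "v \<in> {x. a \<bullet> x = 0}\<^sup>\<bottom>"
    by (auto simp: v_def orthogonal_comp_def orthogonal_def inner_commute)
  ultimately have "hyperplane_reflection {x. a \<bullet> x = 0} (x - v + v) = x - v - v"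
    by (intro hyperplane_reflection_eq subspace_hyperplane)
  then show "hyperplane_reflection {x. a \<bullet> x = 0} x = reflect a x"
    by (simp add: reflect_def v_def diff_diff_eq flip: scaleR_add_left)
qed

lemma hyperplane_iff_normal:
  fixes H :: "'a::euclidean_space set"
  shows "hyperplane H \<longleftrightarrow> (\<exists>a. a \<noteq> 0 \<and> H = {x. a \<bullet> x = 0})"
proof
  assume "hyperplane H"
  then have "subspace H" "dim H = DIM('a) - 1"
    by (auto simp: hyperplane_def)
  then show "\<exists>a. a \<noteq> 0 \<and> H = {x. a \<bullet> x = 0}"
    unfolding dim_eq_hyperplane by (metis span_eq_iff)
next
  assume "\<exists>a. a \<noteq> 0 \<and> H = {x. a \<bullet> x = 0}"
  then show "hyperplane H"
    using DIM_positive[where 'a='a]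
    by (auto simp: hyperplane_def subspace_hyperplane dim_hyperplane)
qed

text \<open>The common subspace of codimension 2 is the orthogonal complement of the plane spanned
  by \<open>a\<close> and \<open>b\<close>: it lies in each hyperplane whose normal is in that
  plane.\<close>

lemma in_common_pencil_normals:
  fixes a b :: "'a::euclidean_space"
  assumes "independent {a, b}" "a \<noteq> b" and V: "V \<subseteq> span {a, b}" "0 \<notin> V"
  shows "in_common_pencil ((\<lambda>v. {x. v \<bullet> x = 0}) ` V)"
proof -
  let ?W = "{y. \<forall>x\<in>span {a, b}. orthogonal x y}"
  have "dim {y \<in> UNIV. \<forall>x\<in>span {a, b}. orthogonal x y} + dim (span {a, b}) = dim (UNIV :: 'a set)"
    by (rule dim_subspace_orthogonal_to_vectors) auto
  moreover have "dim (span {a, b}) = 2"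
    using assms by (simp add: dim_eq_card_independent)
  ultimately have "dim ?W + 2 = DIM('a)"
    by simp
  moreover have "subspace ?W"
    by (auto simp: subspace_def orthogonal_def inner_right_distrib)
  moreover have "hyperplane {x. v \<bullet> x = 0}" if "v \<in> V" for v
    unfolding hyperplane_iff_normal using that V(2) by (intro exI[of _ v]) auto
  moreover have "?W \<subseteq> {x. v \<bullet> x = 0}" if "v \<in> V" for v
    using that V(1) by (auto simp: orthogonal_def)
  ultimately show ?thesis
    unfolding in_common_pencil_def by (intro exI[of _ ?W]) auto
qed

section \<open>Exchanging two reflections within a pencil\<close>

text \<open>
  In the Clifford algebra the reflection in \<open>v\<close> is \<open>x \<mapsto> - v x v\<^sup>-\<^sup>1\<close>, and \<open>d\<close> below is the product \<open>a b c\<close>,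
  which is a vector since \<open>a\<close>, \<open>b\<close>, \<open>c\<close> are coplanar.
\<close>

lemma reflect_three_coplanar:
  fixes a b :: "'a::real_inner"
  assumes c: "c = s *\<^sub>R a + t *\<^sub>R b" and d: "d = (a \<bullet> b) *\<^sub>R c - (a \<bullet> c) *\<^sub>R b + (b \<bullet> c) *\<^sub>R a"
    and nz: "a \<noteq> 0" "b \<noteq> 0" "c \<noteq> 0"
  shows "d \<noteq> 0" "reflect a \<circ> reflect b = reflect d \<circ> reflect c"
proof -
  define A B P where "A = a \<bullet> a" and "B = b \<bullet> b" and "P = a \<bullet> b"
  have cc: "c \<bullet> c = s\<^sup>2 * A + 2 * s * t * P + t\<^sup>2 * B"
    by (simp add: c A_def B_def P_def inner_simps inner_commute power2_eq_square algebra_simps)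
  have ab: "d = (2 * s * P + t * B) *\<^sub>R a - (s * A) *\<^sub>R b"
    by (simp add: c d A_def B_def P_def inner_simps inner_commute algebra_simps)
      (simp flip: scaleR_add_left)
  \<comment> \<open>The squared norm is multiplicative on Clifford products of vectors; this makes
    \<open>d\<close> nonzero.\<close>
  have dd: "d \<bullet> d = A * B * (c \<bullet> c)"
    unfolding cc unfolding ab
    by (simp add: inner_simps inner_commute power2_eq_square algebra_simps
        flip: A_def B_def P_def)
  have pos: "A \<noteq> 0" "B \<noteq> 0" "c \<bullet> c \<noteq> 0"
    using nz by (simp_all add: A_def B_def)
  with dd show "d \<noteq> 0"
    by auto
  have "reflect a (reflect b (reflect c x)) = reflect d x" for x
  proof -
    define C X Y where "C = c \<bullet> c" and "X = a \<bullet> x" and "Y = b \<bullet> x"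
    have C: "C = s\<^sup>2 * A + 2 * s * t * P + t\<^sup>2 * B" "C \<noteq> 0"
      using cc pos by (simp_all add: C_def)
    \<comment> \<open>\<open>k\<close>, \<open>l\<close>, \<open>m\<close> are the multiples of
      \<open>c\<close>, \<open>b\<close>, \<open>a\<close> that the three reflections subtract in
      turn, and \<open>n\<close> is the multiple of \<open>d\<close> that \<open>reflect d\<close>
      subtracts. It remains to compare the coefficients of \<open>a\<close> and
      \<open>b\<close>.\<close>
    define k where "k = 2 * (s * X + t * Y) / C"
    define l where "l = 2 * (Y - k * (s * P + t * B)) / B"
    define m where "m = 2 * (X - k * (s * A + t * P) - l * P) / A"
    define n where "n = 2 * ((2 * s * P + t * B) * X - s * A * Y) / (A * B * C)"
    have 1: "reflect c x = x - k *\<^sub>R c"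
      by (simp add: reflect_def k_def C_def X_def Y_def c inner_simps)
    have 2: "reflect b (reflect c x) = x - k *\<^sub>R c - l *\<^sub>R b"
      unfolding 1 by (simp add: reflect_def l_def B_def P_def Y_def c inner_simps inner_commute)
    have 3: "reflect a (reflect b (reflect c x)) = x - k *\<^sub>R c - l *\<^sub>R b - m *\<^sub>R a"
      unfolding 2 by (simp add: reflect_def m_def A_def P_def X_def c inner_simps inner_commute)
    have 4: "reflect d x = x - n *\<^sub>R d"
      unfolding reflect_def dd n_def
      by (simp add: ab C_def X_def Y_def inner_simps)
    have eqs: "k * C = 2 * (s * X + t * Y)" "l * B = 2 * (Y - k * (s * P + t * B))"
      "m * A = 2 * (X - k * (s * A + t * P) - l * P)"
      "n * (A * B * C) = 2 * ((2 * s * P + t * B) * X - s * A * Y)"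
      using C(2) pos by (simp_all add: k_def l_def m_def n_def)
    \<comment> \<open>Multiplying by nonzero factors clears the denominators, so that the claim
      follows from the polynomial equations \<open>eqs\<close>; the factor is cancelled
      afterwards.\<close>
    have "(k * t + l + n * s * A) * (B * C) = 0"
      using eqs C(1) by algebra
    then have kl: "k * t + l = - n * s * A"
      using C(2) pos by (simp add: eq_neg_iff_add_eq_0)
    have "(k * s + m - n * (2 * s * P + t * B)) * (A * B * C) = 0"
      using eqs C(1) by algebra
    then have km: "k * s + m = n * (2 * s * P + t * B)"
      using C(2) pos by simp
    have "k *\<^sub>R c + l *\<^sub>R b + m *\<^sub>R a = (k * s + m) *\<^sub>R a + (k * t + l) *\<^sub>R b"
      by (simp add: c algebra_simps)
    also have "\<dots> = n *\<^sub>R d"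
      unfolding kl km by (simp add: ab algebra_simps)
    finally show ?thesis
      by (simp add: 3 4 diff_diff_eq)
  qed
  from this[of "reflect c _"] show "reflect a \<circ> reflect b = reflect d \<circ> reflect c"
    by (simp add: fun_eq_iff reflect_involution)
qed

lemma exchange_reflections:
  fixes a b e :: "'a::real_inner"
  assumes nz: "a \<noteq> 0" "b \<noteq> 0" and indep: "\<nexists>k. b = k *\<^sub>R a"
  obtains c d where "c \<in> span {a, b}" "d \<in> span {a, b}" "c \<noteq> 0" "d \<noteq> 0" "c \<bullet> e = 0"
    "reflect a \<circ> reflect b = reflect d \<circ> reflect c"
proof -
  \<comment> \<open>If \<open>a\<close> is orthogonal to \<open>e\<close>, take \<open>a\<close>
    itself. Otherwise eliminate the component along \<open>e\<close> by
    \<open>(b \<bullet> e) *\<^sub>R a - (a \<bullet> e) *\<^sub>R b\<close>, which could vanish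
    only if \<open>b\<close> were a multiple of \<open>a\<close>.\<close>
  obtain s t where c: "s *\<^sub>R a + t *\<^sub>R b \<noteq> 0" "(s *\<^sub>R a + t *\<^sub>R b) \<bullet> e = 0"
  proof (cases "a \<bullet> e = 0")
    case True
    with nz show ?thesis by (intro that[of 1 0]) auto
  next
    case False
    have "b \<noteq> ((b \<bullet> e) / (a \<bullet> e)) *\<^sub>R a"
      using indep by blast
    with False have "(b \<bullet> e) *\<^sub>R a + (- (a \<bullet> e)) *\<^sub>R b \<noteq> 0"
      by (auto simp: eq_vector_fraction_iff)
    then show ?thesis
      by (rule that) (simp add: inner_simps)
  qed
  define c where "c = s *\<^sub>R a + t *\<^sub>R b"
  define d where "d = (a \<bullet> b) *\<^sub>R c - (a \<bullet> c) *\<^sub>R b + (b \<bullet> c) *\<^sub>R a"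
  have "c \<noteq> 0" "c \<bullet> e = 0"
    using c by (simp_all add: c_def)
  moreover from this have "d \<noteq> 0" "reflect a \<circ> reflect b = reflect d \<circ> reflect c"
    using reflect_three_coplanar[OF c_def d_def] nz by simp_all
  moreover have c_span: "c \<in> span {a, b}"
    unfolding c_def by (intro span_add span_scale span_base) auto
  moreover have "d \<in> span {a, b}"
    unfolding d_def by (intro span_add span_diff span_scale c_span) (auto intro: span_base)
  ultimately show ?thesis
    using that by blast
qed

section \<open>Groups in which the pencil and involution relations hold\<close>

text \<open>The intended instance is the quotient of the free group by a normal subgroup containing
  the relators. Rewriting a word then becomes an equality between group elements.\<close>

locale reflection_relations = group G for G (structure) +
  fixes f :: "'v::euclidean_space set \<Rightarrow> 'a"
  assumes f_closed: "hyperplane H \<Longrightarrow> f H \<in> carrier G"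
    and f_involution: "hyperplane H \<Longrightarrow> f H \<otimes> f H = \<one>"
    and f_pencil: "\<lbrakk>in_common_pencil {L, M, L', M'};
      hyperplane_reflection M \<circ> hyperplane_reflection L =
        hyperplane_reflection M' \<circ> hyperplane_reflection L'\<rbrakk>
      \<Longrightarrow> f M \<otimes> f L = f M' \<otimes> f L'"
begin

text \<open>Words are kept as lists of normal vectors, so that inner products and spans can guide
  the rewriting. \<open>gen_prod\<close> evaluates such a list in the group,
  \<open>reflect_prod\<close> as an isometry.\<close>

definition gen :: "'v \<Rightarrow> 'a" where
  "gen v = f {x. v \<bullet> x = 0}"

definition gen_prod :: "'v list \<Rightarrow> 'a" where
  "gen_prod vs = foldr (\<lambda>v g. gen v \<otimes> g) vs \<one>"

definition reflect_prod :: "'v list \<Rightarrow> 'v \<Rightarrow> 'v" where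
  "reflect_prod vs = foldr (\<lambda>v g. reflect v \<circ> g) vs id"

lemma gen_prod_simps [simp]:
  "gen_prod [] = \<one>" "gen_prod (v # vs) = gen v \<otimes> gen_prod vs"
  by (simp_all add: gen_prod_def)

lemma reflect_prod_simps [simp]:
  "reflect_prod [] = id" "reflect_prod (v # vs) = reflect v \<circ> reflect_prod vs"
  by (simp_all add: reflect_prod_def)

lemma gen_closed [simp]: "v \<noteq> 0 \<Longrightarrow> gen v \<in> carrier G"
  unfolding gen_def by (rule f_closed) (auto simp: hyperplane_iff_normal)

lemma gen_involution: "v \<noteq> 0 \<Longrightarrow> gen v \<otimes> gen v = \<one>"
  unfolding gen_def by (rule f_involution) (auto simp: hyperplane_iff_normal)

lemma gen_scaleR: "k \<noteq> 0 \<Longrightarrow> gen (k *\<^sub>R v) = gen v"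
  by (simp add: gen_def)

lemma gen_prod_closed [simp]: "0 \<notin> set vs \<Longrightarrow> gen_prod vs \<in> carrier G"
  by (induction vs) auto

lemma gen_exchange:
  assumes nz: "a \<noteq> 0" "b \<noteq> 0" and indep: "\<nexists>k. b = k *\<^sub>R a"
  obtains c d where "c \<in> span {a, b}" "d \<in> span {a, b}" "c \<noteq> 0" "d \<noteq> 0" "c \<bullet> e = 0"
    "reflect a \<circ> reflect b = reflect d \<circ> reflect c" "gen a \<otimes> gen b = gen d \<otimes> gen c"
proof -
  obtain c d where cd: "c \<in> span {a, b}" "d \<in> span {a, b}" "c \<noteq> 0" "d \<noteq> 0" "c \<bullet> e = 0"
    "reflect a \<circ> reflect b = reflect d \<circ> reflect c"
    using exchange_reflections[OF assms] .
  have "a \<noteq> b"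
    using indep by (metis scaleR_one)
  moreover have "independent {a, b}"
    using nz indep \<open>a \<noteq> b\<close> by (auto simp: insert_commute[of a] independent_insert span_singleton)
  \<comment> \<open>The order matches \<open>{L, M, L', M'}\<close> in
    \<open>f_pencil\<close>.\<close>
  moreover have "{b, a, c, d} \<subseteq> span {a, b}" "0 \<notin> {b, a, c, d}"
    using nz cd by (auto intro: span_base)
  ultimately have "in_common_pencil ((\<lambda>v. {x. v \<bullet> x = 0}) ` {b, a, c, d})"
    by (intro in_common_pencil_normals)
  then have "gen a \<otimes> gen b = gen d \<otimes> gen c"
    unfolding gen_def using cd(6) by (intro f_pencil) (simp_all add: reflect_hyperplane)
  with cd that show ?thesis
    by blast
qed

section \<open>Rewriting words\<close>

text \<open>Letters are processed from the right. \<open>us\<close> holds at most one letter, the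
  only one allowed not to be orthogonal to \<open>e\<close>. A new letter fills this place if it is
  free; otherwise it cancels the letter there or is exchanged with it. Keeping all letters in
  \<open>V\<close> preserves the orthogonality to earlier vectors.\<close>

lemma move_to_front:
  assumes V: "subspace V" and "set vs \<subseteq> V - {0}"
  obtains us ws where "length us \<le> 1" "set us \<subseteq> V - {0}" "set ws \<subseteq> V \<inter> {x. x \<bullet> e = 0} - {0}"
    "gen_prod vs = gen_prod (us @ ws)" "reflect_prod vs = reflect_prod (us @ ws)"
proof -
  have "\<exists>us ws. length us \<le> 1 \<and> set us \<subseteq> V - {0} \<and> set ws \<subseteq> V \<inter> {x. x \<bullet> e = 0} - {0} \<and>
    gen_prod vs = gen_prod (us @ ws) \<and> reflect_prod vs = reflect_prod (us @ ws)"
    using assms(2)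
  proof (induction vs)
    case Nil
    show ?case by (intro exI[of _ "[]"]) simp
  next
    case (Cons a vs)
    then have a: "a \<in> V" "a \<noteq> 0"
      by auto
    from Cons obtain us ws where IH: "length us \<le> 1" "set us \<subseteq> V - {0}"
      "set ws \<subseteq> V \<inter> {x. x \<bullet> e = 0} - {0}"
      "gen_prod vs = gen_prod (us @ ws)" "reflect_prod vs = reflect_prod (us @ ws)"
      by auto
    show ?case
    proof (cases us)
      case Nil
      with IH a show ?thesis
        by (intro exI[of _ "[a]"] exI[of _ ws]) auto
    next
      case (Cons b us')
      with IH have us: "us = [b]" and b: "b \<in> V" "b \<noteq> 0"
        by auto
      have ws: "gen_prod ws \<in> carrier G"
        using IH(3) by (intro gen_prod_closed) auto
      show ?thesis
      proof (cases "\<exists>k. b = k *\<^sub>R a")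
        \<comment> \<open>Parallel normals define the same hyperplane, so the two letters cancel by
          the involution relation and the front place becomes free.\<close>
        case True
        then obtain k where "b = k *\<^sub>R a" "k \<noteq> 0"
          using b by auto
        then have "gen b = gen a" "reflect b = reflect a"
          by (simp_all add: gen_scaleR reflect_scaleR)
        with IH a us ws show ?thesis
          by (intro exI[of _ "[]"] exI[of _ ws])
            (auto simp: m_assoc[symmetric] gen_involution reflect_involution fun_eq_iff)
      next
        case False
        obtain c d where cd: "c \<in> span {a, b}" "d \<in> span {a, b}" "c \<noteq> 0" "d \<noteq> 0" "c \<bullet> e = 0"
          "reflect a \<circ> reflect b = reflect d \<circ> reflect c" "gen a \<otimes> gen b = gen d \<otimes> gen c"
          using gen_exchange[OF a(2) b(2) False] .
        \<comment> \<open>Now \<open>d\<close> takes the front place and \<open>c\<close>, being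
          orthogonal to \<open>e\<close>, joins \<open>ws\<close>.\<close>
        have "span {a, b} \<subseteq> V"
          using V a b by (intro span_minimal) auto
        moreover have "gen a \<otimes> (gen b \<otimes> gen_prod ws) = gen d \<otimes> (gen c \<otimes> gen_prod ws)"
          using cd a b ws by (simp add: m_assoc[symmetric])
        moreover have "reflect a \<circ> (reflect b \<circ> reflect_prod ws)
            = reflect d \<circ> (reflect c \<circ> reflect_prod ws)"
          using cd(6) by (simp only: o_assoc)
        ultimately show ?thesis
          using IH us cd by (intro exI[of _ "[d]"] exI[of _ "c # ws"]) auto
      qed
    qed
  qed
  then show ?thesis
    using that by blast
qed

lemma reflect_prod_fix: "set vs \<subseteq> {x. x \<bullet> e = 0} \<Longrightarrow> reflect_prod vs e = e"
  by (induction vs) (auto simp: reflect_fix)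

lemma reduce_orthogonal:
  assumes "subspace V" "set vs \<subseteq> V - {0}" "reflect_prod vs = id"
  obtains ws where "set ws \<subseteq> V \<inter> {x. x \<bullet> e = 0} - {0}"
    "gen_prod vs = gen_prod ws" "reflect_prod ws = id"
proof -
  obtain us ws where *: "length us \<le> 1" "set us \<subseteq> V - {0}"
    "set ws \<subseteq> V \<inter> {x. x \<bullet> e = 0} - {0}"
    "gen_prod vs = gen_prod (us @ ws)" "reflect_prod vs = reflect_prod (us @ ws)"
    using move_to_front[OF assms(1,2)] .
  have "set us \<subseteq> {x. x \<bullet> e = 0}"
  proof (cases us)
    case (Cons b us')
    with * have us: "us = [b]"
      by simp
    \<comment> \<open>All letters of \<open>ws\<close> fix \<open>e\<close>, and so does the whole
      product; hence the remaining reflection fixes \<open>e\<close> too.\<close>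
    have "reflect_prod ws e = e"
      using *(3) by (intro reflect_prod_fix) auto
    then have "reflect b e = e"
      using * assms(3) us by (metis append_Cons append_Nil comp_apply id_apply reflect_prod_simps(2))
    then show ?thesis
      using us by (simp add: reflect_fixD)
  qed simp
  with * assms(3) show ?thesis
    by (intro that[of "us @ ws"]) auto
qed

lemma gen_prod_eq_one:
  assumes "0 \<notin> set vs" "reflect_prod vs = id"
  shows "gen_prod vs = \<one>"
proof -
  \<comment> \<open>Induction on the set \<open>E\<close> of vectors treated so far; its orthogonal
    complement serves as \<open>V\<close>.\<close>
  have "\<exists>ws. set ws \<subseteq> {x. \<forall>e\<in>E. x \<bullet> e = 0} - {0} \<and> gen_prod vs = gen_prod ws \<and>
      reflect_prod ws = id" if "finite E" for E
    using that
  proof (induction E)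
    case empty
    show ?case using assms by (intro exI[of _ vs]) auto
  next
    case (insert e E)
    then obtain ws where ws: "set ws \<subseteq> {x. \<forall>e\<in>E. x \<bullet> e = 0} - {0}"
      "gen_prod vs = gen_prod ws" "reflect_prod ws = id"
      by blast
    have "subspace {x. \<forall>e\<in>E. x \<bullet> e = 0}"
      by (auto simp: subspace_def inner_simps)
    from reduce_orthogonal[OF this ws(1,3), of e] obtain us where
      "set us \<subseteq> {x. \<forall>e\<in>E. x \<bullet> e = 0} \<inter> {x. x \<bullet> e = 0} - {0}"
      "gen_prod ws = gen_prod us" "reflect_prod us = id"
      by blast
    with ws(2) show ?case
      by (intro exI[of _ us]) auto
  qed
  from this[OF finite_Basis] obtain ws where
    "set ws \<subseteq> {x. \<forall>e\<in>Basis. x \<bullet> e = 0} - {0}" and vs: "gen_prod vs = gen_prod ws"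
    by blast
  \<comment> \<open>Only the zero vector is orthogonal to the whole basis, so no letter is
    left.\<close>
  moreover have "{x::'v. \<forall>e\<in>Basis. x \<bullet> e = 0} - {0} = {}"
    by (auto intro: euclidean_eqI)
  ultimately have "ws = []"
    by simp
  with vs show ?thesis
    by simp
qed

theorem prod_eq_one:
  assumes "\<forall>H\<in>set Hs. hyperplane H" "foldr (\<circ>) (map hyperplane_reflection Hs) id = id"
  shows "foldr (\<otimes>) (map f Hs) \<one> = \<one>"
proof -
  from assms(1) have "\<exists>vs. 0 \<notin> set vs \<and> Hs = map (\<lambda>v. {x. v \<bullet> x = 0}) vs"
  proof (induction Hs)
    case (Cons H Hs)
    then obtain v vs where "v \<noteq> 0" "H = {x. v \<bullet> x = 0}" "0 \<notin> set vs"
      "Hs = map (\<lambda>v. {x. v \<bullet> x = 0}) vs"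
      by (auto simp: hyperplane_iff_normal)
    then show ?case
      by (intro exI[of _ "v # vs"]) simp
  qed simp
  then obtain vs where vs: "0 \<notin> set vs" and Hs: "Hs = map (\<lambda>v. {x. v \<bullet> x = 0}) vs"
    by blast
  have "foldr (\<circ>) (map hyperplane_reflection Hs) id = reflect_prod vs"
    unfolding Hs by (induction vs) (simp_all add: reflect_hyperplane)
  moreover have "foldr (\<otimes>) (map f Hs) \<one> = gen_prod vs"
    unfolding Hs by (induction vs) (simp_all add: gen_def)
  ultimately show ?thesis
    using gen_prod_eq_one[OF vs] assms(2) by simp
qed

end

section \<open>Passing to quotients of the free group\<close>

text \<open>Membership in the carrier is proved simultaneously because the induction needs it to
  apply the homomorphism law.\<close>

lemma (in group_hom) hom_foldr_mult:
  "set xs \<subseteq> carrier G \<Longrightarrow>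
    foldr (\<otimes>) xs \<one> \<in> carrier G \<and> h (foldr (\<otimes>) xs \<one>) = foldr (\<otimes>\<^bsub>H\<^esub>) (map h xs) \<one>\<^bsub>H\<^esub>"
  by (induction xs) auto

theorem theorem8:
  fixes Hs :: "(real ^ 'n) set list"
  assumes "\<forall>H\<in>set Hs. hyperplane H"
    and "foldr (\<circ>) (map hyperplane_reflection Hs) id = id"
  shows "follows_from_pencil_and_involution_relations Hs"
  unfolding follows_from_pencil_and_involution_relations_def normal_closure_def hull_def
\<comment> \<open>The normal closure is the intersection of all normal subgroups \<open>N\<close>
  containing the relators. For each of them, it suffices that the word becomes trivial modulo
  \<open>N\<close>.\<close>
proof (intro InterI, clarify)
  let ?F = "reflection_symbol_group :: ((real ^ 'n) set \<times> bool) list monoid"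
  fix N assume N: "N \<lhd> ?F" and rel: "involution_relators \<union> pencil_relators \<subseteq> N"
  interpret N: normal N ?F by (rule N)
  let ?h = "\<lambda>x. N #>\<^bsub>?F\<^esub> x"
  interpret h: group_hom ?F "?F Mod N" ?h
    by (intro group_hom.intro group_hom_axioms.intro N.is_group N.factorgroup_is_group
        N.r_coset_hom_Mod)
  have kernel: "?h x = \<one>\<^bsub>?F Mod N\<^esub>" if "x \<in> N" for x
    using that by (simp add: N.coset_join2 N.subgroup_axioms N.mem_carrier)
  \<comment> \<open>Since the relators lie in \<open>N\<close>, the cosets of the generators satisfy
    both kinds of relations.\<close>
  interpret Q: reflection_relations "?F Mod N" "\<lambda>H. ?h (free_gen H)"
  proof
    fix H :: "(real ^ 'n) set" assume H: "hyperplane H"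
    then have gen: "free_gen H \<in> carrier ?F"
      by (simp add: free_gen_closed)
    then show "?h (free_gen H) \<in> carrier (?F Mod N)"
      by (rule h.hom_closed)
    have "free_gen H [^]\<^bsub>?F\<^esub> (2::nat) \<in> N"
      using rel H by (auto simp: involution_relators_def)
    then have "?h (free_gen H \<otimes>\<^bsub>?F\<^esub> free_gen H) = \<one>\<^bsub>?F Mod N\<^esub>"
      using gen by (intro kernel) (simp add: numeral_2_eq_2)
    then show "?h (free_gen H) \<otimes>\<^bsub>?F Mod N\<^esub> ?h (free_gen H) = \<one>\<^bsub>?F Mod N\<^esub>"
      using gen by (simp only: h.hom_mult)
  next
    fix L M L' M' :: "(real ^ 'n) set"
    assume pencil: "in_common_pencil {L, M, L', M'}"
      and eq: "hyperplane_reflection M \<circ> hyperplane_reflection L =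
        hyperplane_reflection M' \<circ> hyperplane_reflection L'"
    let ?x = "free_gen M \<otimes>\<^bsub>?F\<^esub> free_gen L" and ?y = "free_gen M' \<otimes>\<^bsub>?F\<^esub> free_gen L'"
    have gens: "free_gen L \<in> carrier ?F" "free_gen M \<in> carrier ?F"
      "free_gen L' \<in> carrier ?F" "free_gen M' \<in> carrier ?F"
      using pencil by (auto simp: in_common_pencil_def intro: free_gen_closed)
    have "?x \<otimes>\<^bsub>?F\<^esub> inv\<^bsub>?F\<^esub> ?y \<in> N"
      using rel pencil eq unfolding pencil_relators_def by blast
    then have "?h ?x \<otimes>\<^bsub>?F Mod N\<^esub> inv\<^bsub>?F Mod N\<^esub> ?h ?y = \<one>\<^bsub>?F Mod N\<^esub>"
      using kernel gens by (metis h.hom_mult h.hom_inv N.m_closed N.inv_closed)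
    then have "?h ?x = ?h ?y"
      using gens by (metis h.H.inv_solve_right' h.H.l_one h.H.one_closed h.hom_closed N.m_closed)
    then show "?h (free_gen M) \<otimes>\<^bsub>?F Mod N\<^esub> ?h (free_gen L) =
        ?h (free_gen M') \<otimes>\<^bsub>?F Mod N\<^esub> ?h (free_gen L')"
      using gens by (simp only: h.hom_mult)
  qed
  have "set (map free_gen Hs) \<subseteq> carrier ?F"
    using assms(1) by (auto intro: free_gen_closed)
  from h.hom_foldr_mult[OF this]
  have w: "reflection_word Hs \<in> carrier ?F" and
    "?h (reflection_word Hs) = foldr (\<otimes>\<^bsub>?F Mod N\<^esub>) (map (\<lambda>H. ?h (free_gen H)) Hs) \<one>\<^bsub>?F Mod N\<^esub>"
    by (simp_all only: reflection_word_def map_map comp_def)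
  \<comment> \<open>The identity of the quotient is the coset \<open>N\<close> itself.\<close>
  then have "?h (reflection_word Hs) = N"
    using Q.prod_eq_one[OF assms] by simp
  then show "reflection_word Hs \<in> N"
    using w by (rule N.coset_join1[OF _ _ N.subgroup_axioms])
qed

end
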